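(* Let $(Ap_n(x))_{n\ge0}$ be any Appell sequence, let $n\in\mathbb{N}$, $a\in\mathbb{R}$, and let $f$ be an arbitrary differentiable function (for which the fractional derivatives below exist). Then \[ (\partial_x)^{a}\,[Ap_n(x) f(x)] = \sum_{m=0}^{n}\binom{n}{m}\,Ap_{n-m}(x)\,(a)_{m}\,(\partial_x)^{a-m}[f(x)]. \]
   Context: An Appell sequence is a polynomial sequence $Ap_n(x)$ with generating function $\frac{1}{g(t)}e^{xt}=\sum_{n\ge0}\frac{Ap_n(x)t^n}{n!}$, where $g(t)$ is a power series with nonzero constant term; it satisfies $\partial_x Ap_n(x)=n\,Ap_{n-1}(x)$. $(a)_m = a(a-1)\cdots(a-m+1)$ is the falling factorial, $(a)_0=1$, and $\binom{a}{m}=(a)_m/m!$. For $a\in\mathbb{R}$, $(\partial_x)^a$ denotes fractional differentiation of order $a$ with respect to $x$: a family of linear operators which agree with the ordinary derivative of order $a$ when $a$ is a nonnegative integer and which obey the extension of the general Leibniz rule to real order: for a polynomial $p$ and a function $f$ for which the terms exist, \[ (\partial_x)^a[p(x)f(x)] = \sum_{m=0}^{\infty}\binom{a}{m}\,(\partial_x)^{a-m}[f(x)]\;p^{(m)}(x). \] *)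

theory Defs
  imports "HOL-Analysis.Analysis" "HOL-Computational_Algebra.Computational_Algebra"
begin

text \<open>
  Everything is stated over an arbitrary real normed field, which covers both a real
  variable with real values and a complex variable with complex values.
\<close>

definition falling_factorial :: "'a::comm_ring_1 \<Rightarrow> nat \<Rightarrow> 'a" where
  "falling_factorial a m = (\<Prod>i<m. a - of_nat i)"

text \<open>
  The generating function identity is one of formal power series in \<open>t\<close>, for every value
  of \<open>x\<close>; \<^const>\<open>fps_exp\<close> \<open>x\<close> is the series of \<open>e\<^sup>x\<^sup>t\<close>.
\<close>

definition appell_sequence :: "(nat \<Rightarrow> 'a::real_normed_field poly) \<Rightarrow> bool" where
  "appell_sequence Ap \<longleftrightarrow>
     (\<exists>g :: 'a fps. fps_nth g 0 \<noteq> 0 \<and>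
        (\<forall>x. inverse g * fps_exp x = Abs_fps (\<lambda>n. poly (Ap n) x / fact n)))"

text \<open>The set \<open>X\<close> is meant to be open, so that derivatives at its points only depend on
  the values of the function on \<open>X\<close>.\<close>

definition times_differentiable_on ::
  "nat \<Rightarrow> ('a::real_normed_field \<Rightarrow> 'a) \<Rightarrow> 'a set \<Rightarrow> bool" where
  "times_differentiable_on n f X \<longleftrightarrow>
     (\<forall>k<n. \<forall>x\<in>X. (deriv ^^ k) f field_differentiable (at x))"

text \<open>
  A fractional differentiation on an open set \<open>X\<close>: \<open>Dom a\<close> is the set of functions whose
  derivative of order \<open>a\<close> exists (on \<open>X\<close>), and \<open>D a f\<close> is that derivative. The values of
  \<open>D a f\<close> for \<open>f\<close> outside \<open>Dom a\<close>, or at points outside \<open>X\<close>, carry no meaning.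

  In the Leibniz rule, the terms with \<open>m > degree p\<close> vanish because their polynomial
  factor does, so only the terms with \<open>m \<le> degree p\<close> are required to exist. That the
  derivative on the left-hand side exists is a premise of the rule, not a conclusion.
\<close>

locale fractional_derivative =
  fixes X :: "'a::real_normed_field set"
    and Dom :: "real \<Rightarrow> ('a \<Rightarrow> 'a) set"
    and D :: "real \<Rightarrow> ('a \<Rightarrow> 'a) \<Rightarrow> 'a \<Rightarrow> 'a"
  assumes open_X: "open X"
    and zero_in_Dom: "(\<lambda>_. 0) \<in> Dom a"
    and lincomb_in_Dom:
      "f \<in> Dom a \<Longrightarrow> h \<in> Dom a \<Longrightarrow> (\<lambda>x. c * f x + d * h x) \<in> Dom a"
    and D_lincomb:
      "f \<in> Dom a \<Longrightarrow> h \<in> Dom a \<Longrightarrow> x \<in> X \<Longrightarrow>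
        D a (\<lambda>x. c * f x + d * h x) x = c * D a f x + d * D a h x"
    and Dom_of_nat: "f \<in> Dom (real k) \<longleftrightarrow> times_differentiable_on k f X"
    and D_of_nat: "f \<in> Dom (real k) \<Longrightarrow> x \<in> X \<Longrightarrow> D (real k) f x = (deriv ^^ k) f x"
    and Leibniz:
      "(\<lambda>x. poly p x * f x) \<in> Dom a \<Longrightarrow>
       (\<And>m. m \<le> degree p \<Longrightarrow> f \<in> Dom (a - real m)) \<Longrightarrow> x \<in> X \<Longrightarrow>
        (\<lambda>m. of_real (a gchoose m) * D (a - real m) f x * poly ((pderiv ^^ m) p) x)
          sums D a (\<lambda>x. poly p x * f x) x"

end

theory Submission
  imports Defs
begin

text \<open>
  Comparing coefficients of the generating function shows that \<open>Ap n\<close> has degree at most \<open>n\<close> and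
  that \<open>Ap n' = n Ap (n - 1)\<close>, hence the \<open>m\<close>-th derivative of \<open>Ap n\<close> is \<open>(n)\<^sub>m Ap (n - m)\<close>.
  The Leibniz series of \<open>Ap n\<close> times \<open>f\<close> thus stops at \<open>m = n\<close>, and the two falling factorials
  exchange their roles: \<open>(a choose m) (n)\<^sub>m = (n choose m) (a)\<^sub>m\<close>.
\<close>

text \<open>The numbers \<open>c j\<close> are the coefficients of \<open>1/g\<close>, so this is
  the Cauchy product of \<open>1/g\<close> with the exponential series, read off at each power of
  \<open>x\<close>.\<close>

lemma appell_sequence_coeff:
  fixes Ap :: "nat \<Rightarrow> 'a::real_normed_field poly"
  assumes "appell_sequence Ap"
  obtains c :: "nat \<Rightarrow> 'a"
    where "\<And>n k. coeff (Ap n) k = (if k \<le> n then fact n / fact k * c (n - k) else 0)"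
proof -
  obtain g :: "'a fps"
    where g: "\<And>x. inverse g * fps_exp x = Abs_fps (\<lambda>n. poly (Ap n) x / fact n)"
    using assms unfolding appell_sequence_def by blast
  define c where "c = fps_nth (inverse g)"
  have "Ap n = (\<Sum>k\<le>n. monom (fact n / fact k * c (n - k)) k)" for n
  \<comment> \<open>The generating function only gives values at points; over an infinite field
    these determine the polynomial.\<close>
  proof (rule poly_eq_poly_eq_iff[THEN iffD1, OF ext])
    fix x
    have "poly (Ap n) x / fact n = fps_nth (fps_exp x * inverse g) n"
      using g[of x] by (simp add: mult.commute)
    also have "\<dots> = (\<Sum>k\<le>n. x ^ k / fact k * c (n - k))"
      by (simp add: fps_mult_nth c_def atLeast0AtMost)
    finally have "poly (Ap n) x = fact n * (\<Sum>k\<le>n. x ^ k / fact k * c (n - k))"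
      by (simp add: field_simps)
    then show "poly (Ap n) x = poly (\<Sum>k\<le>n. monom (fact n / fact k * c (n - k)) k) x"
      by (simp add: poly_sum poly_monom sum_distrib_left mult_ac)
  qed
  then have "coeff (Ap n) k = (if k \<le> n then fact n / fact k * c (n - k) else 0)" for n k
    by (simp add: coeff_sum)
  then show thesis
    by (rule that)
qed

lemma degree_appell_sequence_le:
  assumes "appell_sequence Ap"
  shows "degree (Ap n) \<le> n"
  using assms by (elim appell_sequence_coeff) (simp add: degree_le)

lemma pderiv_appell_sequence_Suc:
  assumes "appell_sequence Ap"
  shows "pderiv (Ap (Suc n)) = smult (of_nat (Suc n)) (Ap n)"
  using assms
  by (elim appell_sequence_coeff) (simp add: poly_eq_iff coeff_pderiv field_simps del: of_nat_Suc)

lemma higher_pderiv_appell_sequence: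
  assumes "appell_sequence Ap"
  shows "m \<le> n \<Longrightarrow> (pderiv ^^ m) (Ap n) = smult (fact n / fact (n - m)) (Ap (n - m))"
proof (induction m)
  case 0
  then show ?case by simp
next
  case (Suc m)
  \<comment> \<open>In this form one more derivative applies to \<open>Ap (n - m)\<close>, and its
    factor \<open>n - m\<close> cancels against \<open>fact (n - m)\<close>.\<close>
  then have "n - m = Suc (n - Suc m)" by simp
  with Suc pderiv_appell_sequence_Suc[OF assms] show ?case
    by (simp add: pderiv_smult del: of_nat_Suc)
qed

lemma higher_pderiv_eq_0:
  "degree p < m \<Longrightarrow> (pderiv ^^ m) p = 0"
  by (rule poly_eqI) (simp add: coeff_higher_pderiv coeff_eq_0)

text \<open>Both sides equal \<open>(a)\<^sub>m\<close> times \<open>n! / (m! (n - m)!)\<close>; the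
  quotient on the left is \<open>(n)\<^sub>m\<close>.\<close>

lemma gbinomial_times_fact_quotient:
  assumes "m \<le> n"
  shows "of_real (a gchoose m) * (fact n / fact (n - m)) =
    (of_nat (n choose m) * of_real (falling_factorial a m) :: 'a::real_normed_field)"
proof -
  have "a gchoose m = falling_factorial a m / fact m"
    by (simp add: gbinomial_prod_rev falling_factorial_def atLeast0LessThan)
  then show ?thesis
    using binomial_fact[OF assms, where 'a = 'a] by simp
qed

theorem theorem4p1:
  fixes X :: "'a::real_normed_field set"
    and Dom :: "real \<Rightarrow> ('a \<Rightarrow> 'a) set"
    and D :: "real \<Rightarrow> ('a \<Rightarrow> 'a) \<Rightarrow> 'a \<Rightarrow> 'a"
    and Ap :: "nat \<Rightarrow> 'a poly"
    and n :: nat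
    and a :: real
    and f :: "'a \<Rightarrow> 'a"
    and x :: 'a
  assumes "fractional_derivative X Dom D"
    and "appell_sequence Ap"
    and "\<And>y. y \<in> X \<Longrightarrow> f field_differentiable (at y)"
    and "(\<lambda>y. poly (Ap n) y * f y) \<in> Dom a"
    and "\<And>m. m \<le> n \<Longrightarrow> f \<in> Dom (a - real m)"
    and "x \<in> X"
  shows "D a (\<lambda>y. poly (Ap n) y * f y) x =
    (\<Sum>m=0..n. of_nat (n choose m) * poly (Ap (n - m)) x *
       of_real (falling_factorial a m) * D (a - real m) f x)"
proof -
  interpret fractional_derivative X Dom D by fact
  note appell = \<open>appell_sequence Ap\<close>
  let ?t = "\<lambda>m. of_real (a gchoose m) * D (a - real m) f x * poly ((pderiv ^^ m) (Ap n)) x"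
  have "?t sums D a (\<lambda>y. poly (Ap n) y * f y) x"
    using assms(4-6) degree_appell_sequence_le[OF appell, of n] by (intro Leibniz) auto
  \<comment> \<open>For \<open>m > n\<close> the \<open>m\<close>-th derivative of
    \<open>Ap n\<close> is zero by degree.\<close>
  moreover have "?t sums (\<Sum>m=0..n. ?t m)"
    using degree_appell_sequence_le[OF appell, of n]
    by (intro sums_finite) (auto simp: higher_pderiv_eq_0)
  ultimately have "D a (\<lambda>y. poly (Ap n) y * f y) x = (\<Sum>m=0..n. ?t m)"
    by (rule sums_unique2)
  \<comment> \<open>Terms are compared for \<open>m \<le> n\<close> only; the sum of these
    identities is the next link of the chain.\<close>
  also have "?t m = of_nat (n choose m) * poly (Ap (n - m)) x *
      of_real (falling_factorial a m) * D (a - real m) f x" if "m \<le> n" for m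
  proof -
    have "?t m = of_real (a gchoose m) * (fact n / fact (n - m)) * poly (Ap (n - m)) x *
        D (a - real m) f x"
      by (simp add: higher_pderiv_appell_sequence[OF appell that])
    then show ?thesis
      by (simp only: gbinomial_times_fact_quotient[OF that] mult_ac)
  qed
  then have "(\<Sum>m=0..n. ?t m) = (\<Sum>m=0..n. of_nat (n choose m) * poly (Ap (n - m)) x *
      of_real (falling_factorial a m) * D (a - real m) f x)"
    by (intro sum.cong) auto
  finally show ?thesis .
qed

end
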